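(* Let $U(\boldsymbol{\theta})\in SU(2)$ be a differentiable family of unitary matrices depending on real parameters $\boldsymbol{\theta}=(\theta_1,\dots,\theta_n)$, and let $\rho_0=p_0|\varphi_0\rangle\langle\varphi_0|+p_1|\varphi_1\rangle\langle\varphi_1|$ be a $\boldsymbol{\theta}$-independent qubit density matrix, where $p_0,p_1\ge 0$, $p_0+p_1=1$, and $\{|\varphi_0\rangle,|\varphi_1\rangle\}$ is an orthonormal basis of $\mathbb{C}^2$ such that $|\varphi_0\rangle$ and $|\varphi_1\rangle$ are eigenvectors of $\boldsymbol{\sigma}\cdot\hat{\boldsymbol{n}}$ with eigenvalues $+1$ and $-1$ respectively, for a unit vector $\hat{\boldsymbol{n}}\in\mathbb{R}^3$. Put $\rho_{\boldsymbol{\theta}}=U(\boldsymbol{\theta})\rho_0U^\dagger(\boldsymbol{\theta})$. To each parameter $\theta_i$ one can associate a unique vector $\boldsymbol{m}_{\theta_i}\in\mathbb{R}^3$ defined by $$[\boldsymbol{m}_{\theta_i}]_k=\tfrac12\mathrm{Tr}\{\sigma_k M_{\theta_i}\},\quad k=1,2,3,\qquad M_{\theta_i}=iU^\dagger(\boldsymbol{\theta})\frac{\partial U(\boldsymbol{\theta})}{\partial\theta_i},$$ and the quantum Fisher information matrix of $\rho_{\boldsymbol{\theta}}$ is $$F_{\theta_i\theta_j}=4(p_0-p_1)^2\,\boldsymbol{m}_{\theta_i}^{\mathrm t}\Lambda_{\hat{\boldsymbol{n}}}\boldsymbol{m}_{\theta_j}=4(p_0-p_1)^2\left[\boldsymbol{m}_{\theta_i}\cdot\boldsymbol{m}_{\theta_j}-(\hat{\boldsymbol{n}}\cdot\boldsymbol{m}_{\theta_i})(\hat{\boldsymbol{n}}\cdot\boldsymbol{m}_{\theta_j})\right],$$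 where $\Lambda_{\hat{\boldsymbol{n}}}=\mathbb{1}_3-\hat{\boldsymbol{n}}\hat{\boldsymbol{n}}^{\mathrm t}$ is the projection onto the two-dimensional subspace of $\mathbb{R}^3$ orthogonal to $\hat{\boldsymbol{n}}$.
   Context: $\boldsymbol{\sigma}=(\sigma_1,\sigma_2,\sigma_3)$ are the Pauli matrices and $\boldsymbol{\sigma}\cdot\boldsymbol{v}=\sum_k v_k\sigma_k$; the superscript $\mathrm t$ denotes transpose. For a differentiable family of density matrices $\rho_{\boldsymbol{\theta}}$, the quantum Fisher information matrix (of symmetric logarithmic derivative type) is $$F_{\theta_i\theta_j}=\tfrac12\mathrm{Tr}\left(\rho_{\boldsymbol{\theta}}\{L_{\theta_i},L_{\theta_j}\}\right),$$ where $\{A,B\}=AB+BA$ and $L_{\theta_i}$ is a Hermitian matrix (symmetric logarithmic derivative, SLD) satisfying $\partial_{\theta_i}\rho_{\boldsymbol{\theta}}=\tfrac12\{L_{\theta_i},\rho_{\boldsymbol{\theta}}\}$. When $\rho_{\boldsymbol{\theta}}$ is not invertible the SLD is not unique, but $F_{\theta_i\theta_j}$ does not depend on the choice. *)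

theory Defs
  imports "HOL-Analysis.Analysis"
begin

type_synonym cmat2 = "complex^2^2"

(* The inner product and "orthogonal" of HOL-Analysis on complex^2 are those of the underlying
   real vector space, so the Hermitian inner product has to be introduced here. *)
definition cinner :: "complex^'d \<Rightarrow> complex^'d \<Rightarrow> complex" where
  "cinner u v = (\<Sum>k\<in>UNIV. cnj (u $ k) * v $ k)"

definition orthonormal_basis :: "complex^2 \<Rightarrow> complex^2 \<Rightarrow> bool" where
  "orthonormal_basis u v \<longleftrightarrow>
     cinner u u = 1 \<and> cinner v v = 1 \<and> cinner u v = 0 \<and> vec.span {u, v} = UNIV"

definition ketbra :: "complex^'d \<Rightarrow> complex^'d \<Rightarrow> complex^'d^'d" where
  "ketbra u v = (\<chi> a b. u $ a * cnj (v $ b))"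

definition dagger :: "complex^'d^'d \<Rightarrow> complex^'d^'d" where
  "dagger A = (\<chi> a b. cnj (A $ b $ a))"

definition hermitian :: "complex^'d^'d \<Rightarrow> bool" where
  "hermitian A \<longleftrightarrow> dagger A = A"

definition SU2 :: "cmat2 set" where
  "SU2 = {V. dagger V ** V = mat 1 \<and> V ** dagger V = mat 1 \<and> det V = 1}"

definition anticommutator :: "complex^'d^'d \<Rightarrow> complex^'d^'d \<Rightarrow> complex^'d^'d" where
  "anticommutator A B = A ** B + B ** A"

definition pauli :: "3 \<Rightarrow> cmat2" where
  "pauli k =
     (if k = 1 then vector [vector [0, 1], vector [1, 0]]
      else if k = 2 then vector [vector [0, - \<i>], vector [\<i>, 0]]
      else vector [vector [1, 0], vector [0, - 1]])"

definition pauli_dot :: "real^3 \<Rightarrow> cmat2" where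
  "pauli_dot v = (\<Sum>k\<in>UNIV. (v $ k) *\<^sub>R pauli k)"

definition has_partial_derivative ::
  "(real^'n \<Rightarrow> 'b::real_normed_vector) \<Rightarrow> 'b \<Rightarrow> 'n \<Rightarrow> real^'n \<Rightarrow> bool" where
  "has_partial_derivative f D i \<theta> \<longleftrightarrow>
     ((\<lambda>t. f (\<theta> + t *\<^sub>R axis i 1)) has_vector_derivative D) (at 0)"

definition partial_derivative ::
  "(real^'n \<Rightarrow> 'b::real_normed_vector) \<Rightarrow> 'n \<Rightarrow> real^'n \<Rightarrow> 'b" where
  "partial_derivative f i \<theta> = vector_derivative (\<lambda>t. f (\<theta> + t *\<^sub>R axis i 1)) (at 0)"

definition is_SLD ::
  "(real^'n \<Rightarrow> complex^'d^'d) \<Rightarrow> real^'n \<Rightarrow> 'n \<Rightarrow> complex^'d^'d \<Rightarrow> bool" where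
  "is_SLD \<rho> \<theta> i L \<longleftrightarrow>
     hermitian L \<and>
     has_partial_derivative \<rho> ((1 / 2) *\<^sub>R anticommutator L (\<rho> \<theta>)) i \<theta>"

(* The SLDs need not be unique, so "F is the quantum Fisher information matrix" is a relation:
   F is computed from some choice of SLDs.  Independence of the choice is not built in. *)
definition is_QFIM ::
  "(real^'n \<Rightarrow> complex^'d^'d) \<Rightarrow> real^'n \<Rightarrow> complex^'n^'n \<Rightarrow> bool" where
  "is_QFIM \<rho> \<theta> F \<longleftrightarrow>
     (\<exists>L. (\<forall>i. is_SLD \<rho> \<theta> i (L i)) \<and>
          (\<forall>i j. F $ i $ j = (1 / 2) * trace (\<rho> \<theta> ** anticommutator (L i) (L j))))"

(* mat \<i> is the scalar matrix \<i> 1, so this is i U^dagger (dU / d theta_i). *)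
definition generator :: "(real^'n \<Rightarrow> cmat2) \<Rightarrow> real^'n \<Rightarrow> 'n \<Rightarrow> cmat2" where
  "generator U \<theta> i = mat \<i> ** (dagger (U \<theta>) ** partial_derivative U i \<theta>)"

(* The coercion on the left makes the reality of the traces part of the condition. *)
definition is_generator_vector :: "(real^'n \<Rightarrow> cmat2) \<Rightarrow> real^'n \<Rightarrow> 'n \<Rightarrow> real^3 \<Rightarrow> bool" where
  "is_generator_vector U \<theta> i m \<longleftrightarrow>
     (\<forall>k. complex_of_real (m $ k) = (1 / 2) * trace (pauli k ** generator U \<theta> i))"

definition Lam :: "real^3 \<Rightarrow> real^3^3" where
  "Lam n = mat 1 - (columnvector n :: real^1^3) ** (rowvector n :: real^3^1)"

definition is_orthogonal_projection :: "real^'k^'k \<Rightarrow> (real^'k) set \<Rightarrow> bool" where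
  "is_orthogonal_projection P W \<longleftrightarrow>
     subspace W \<and> (\<forall>v. P *v v \<in> W \<and> (\<forall>w\<in>W. orthogonal (v - P *v v) w))"

end

theory Submission
  imports Defs
begin

text \<open>
  In Bloch form \<open>\<rho>\<^sub>0 = (1 + r \<sigma>\<cdot>n) / 2\<close> with \<open>r = p\<^sub>0 - p\<^sub>1\<close>, and differentiating
  \<open>U\<^sup>\<dagger> U = 1\<close> and \<open>det U = 1\<close> shows that the generator is Hermitian and traceless, so that it is
  \<open>\<sigma>\<cdot>m\<close> for a unique real \<open>m\<close>.  Hence \<open>\<partial>\<rho> = U (-\<i> [\<sigma>\<cdot>m, \<rho>\<^sub>0]) U\<^sup>\<dagger> = U (r \<sigma>\<cdot>(m \<times> n)) U\<^sup>\<dagger>\<close>.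
  As \<open>m \<times> n\<close> is orthogonal to \<open>n\<close>, the matrices \<open>\<sigma>\<cdot>(m \<times> n)\<close> and \<open>\<sigma>\<cdot>n\<close> anticommute, and
  \<open>U (2 r \<sigma>\<cdot>(m \<times> n)) U\<^sup>\<dagger>\<close> is an SLD.  It yields \<open>F\<^sub>i\<^sub>j = 4 r\<^sup>2 (m\<^sub>i \<times> n) \<bullet> (m\<^sub>j \<times> n)\<close>, to which
  the Lagrange identity applies.  Any other choice of SLDs gives the same value because
  \<open>Tr (\<rho> {A, B})\<close> depends on \<open>A\<close> only through \<open>{A, \<rho>}\<close>, and likewise on \<open>B\<close>.
\<close>

section \<open>Real-linear matrix algebra and derivatives of matrix curves\<close>

lemma linear_dagger: "linear dagger"
  by (auto simp: linear_iff dagger_def vec_eq_iff)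

lemma dagger_matrix_mult: "dagger (A ** B) = dagger B ** dagger A"
  by (simp add: dagger_def matrix_matrix_mult_def vec_eq_iff mult.commute)

lemma dagger_dagger [simp]: "dagger (dagger A) = A"
  by (simp add: dagger_def vec_eq_iff)

text \<open>Bilinearity over the reals serves twice: it yields the rewrite rules below and, implying
  boundedness in finite dimension, the product rule.\<close>

lemma bilinear_matrix_mult:
  "bilinear ((**) :: complex^'b^'a \<Rightarrow> complex^'c^'b \<Rightarrow> complex^'c^'a)"
  by (auto simp: bilinear_def linear_iff matrix_matrix_mult_def vec_eq_iff algebra_simps
      sum.distrib scaleR_sum_right)

lemmas matrix_mult_algebra =
  bilinear_ladd [OF bilinear_matrix_mult] bilinear_radd [OF bilinear_matrix_mult]
  bilinear_lsub [OF bilinear_matrix_mult] bilinear_rsub [OF bilinear_matrix_mult]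
  bilinear_lneg [OF bilinear_matrix_mult] bilinear_rneg [OF bilinear_matrix_mult]
  bilinear_lmul [OF bilinear_matrix_mult] bilinear_rmul [OF bilinear_matrix_mult]

lemma has_vector_derivative_matrix_mult:
  fixes f :: "real \<Rightarrow> complex^'b^'a" and g :: "real \<Rightarrow> complex^'c^'b"
  assumes "(f has_vector_derivative f') (at x)" and "(g has_vector_derivative g') (at x)"
  shows "((\<lambda>t. f t ** g t) has_vector_derivative (f x ** g' + f' ** g x)) (at x)"
  using bounded_bilinear.has_vector_derivative
    [OF bilinear_matrix_mult [unfolded bilinear_conv_bounded_bilinear] assms] .

lemma has_vector_derivative_dagger:
  fixes f :: "real \<Rightarrow> complex^'d^'d"
  assumes "(f has_vector_derivative f') (at x)"
  shows "((\<lambda>t. dagger (f t)) has_vector_derivative dagger f') (at x)"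
  using bounded_linear.has_vector_derivative
    [OF linear_dagger [unfolded linear_conv_bounded_linear] assms] .

section \<open>Traces, anticommutators and independence of the choice of SLDs\<close>

lemma trace_scaleR: "trace (c *\<^sub>R A) = of_real c * trace (A :: complex^'d^'d)"
  by (simp add: trace_def sum_distrib_left scaleR_conv_of_real[where 'a = complex])

lemma anticommutator_commute: "anticommutator A B = anticommutator B A"
  by (simp add: anticommutator_def add.commute)

lemma anticommutator_scaleR:
  "anticommutator (a *\<^sub>R A) (b *\<^sub>R B) = (a * b) *\<^sub>R anticommutator A B"
  by (simp add: anticommutator_def matrix_mult_algebra scaleR_add_right mult.commute)

lemma anticommutator_unitary_conj:
  assumes "dagger V ** V = mat 1"
  shows "anticommutator (V ** A ** dagger V) (V ** B ** dagger V) =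
    V ** anticommutator A B ** dagger V"
proof -
  have "(V ** A ** dagger V) ** (V ** B ** dagger V) = V ** (A ** B) ** dagger V" for A B
    by (metis assms matrix_mul_assoc matrix_mul_lid)
  then show ?thesis
    by (simp add: anticommutator_def matrix_mult_algebra)
qed

lemma trace_unitary_conj:
  assumes "dagger V ** V = mat 1"
  shows "trace (V ** A ** dagger V) = trace A"
  by (metis assms matrix_mul_assoc matrix_mul_lid trace_mul_sym)

lemma hermitian_unitary_conj:
  assumes "hermitian A"
  shows "hermitian (V ** A ** dagger V)"
  using assms by (simp add: hermitian_def dagger_matrix_mult matrix_mul_assoc)

text \<open>Cyclicity of the trace, once per product. On the right \<open>A\<close> occurs only
  inside \<open>anticommutator A R\<close>, which is what an SLD equation prescribes.\<close>

lemma trace_anticommutator_swap: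
  "trace (R ** anticommutator A B) = trace (B ** anticommutator A R)"
  for A B R :: "complex^'d^'d"
proof -
  have "trace (R ** (A ** B)) = trace (B ** (R ** A))" "trace (R ** (B ** A)) = trace (B ** (A ** R))"
    by (metis matrix_mul_assoc trace_mul_sym)+
  then show ?thesis
    by (simp add: anticommutator_def matrix_mult_algebra trace_add)
qed

lemma trace_anticommutator_cong:
  fixes A A' B B' R :: "complex^'d^'d"
  assumes "anticommutator A R = anticommutator A' R" and "anticommutator B R = anticommutator B' R"
  shows "trace (R ** anticommutator A B) = trace (R ** anticommutator A' B')"
  using assms by (metis anticommutator_commute trace_anticommutator_swap)

lemma is_SLD_anticommutator_unique:
  assumes "is_SLD \<rho> \<theta> i L" and "is_SLD \<rho> \<theta> i L'"
  shows "anticommutator L (\<rho> \<theta>) = anticommutator L' (\<rho> \<theta>)"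
  using assms vector_derivative_unique_at
  unfolding is_SLD_def has_partial_derivative_def by fastforce

text \<open>All SLDs for one parameter share their anticommutator with the state, so the existential
  in \<open>is_QFIM\<close> can be evaluated on any known family. That family is also the witness
  for the converse.\<close>

lemma is_QFIM_iff:
  fixes \<rho> :: "real^'n \<Rightarrow> complex^'d^'d"
  assumes "\<And>i. is_SLD \<rho> \<theta> i (L i)"
  shows "is_QFIM \<rho> \<theta> F \<longleftrightarrow>
    (\<forall>i j. F $ i $ j = (1 / 2) * trace (\<rho> \<theta> ** anticommutator (L i) (L j)))"
proof -
  have "trace (\<rho> \<theta> ** anticommutator (L' i) (L' j)) = trace (\<rho> \<theta> ** anticommutator (L i) (L j))"
    if "\<forall>i. is_SLD \<rho> \<theta> i (L' i)" for L' i j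
    using that assms by (intro trace_anticommutator_cong is_SLD_anticommutator_unique) auto
  then show ?thesis
    unfolding is_QFIM_def using assms by metis
qed

section \<open>Pauli algebra, computed entrywise\<close>

lemma pauli_dot_nth:
  "pauli_dot v $ 1 $ 1 = of_real (v $ 3)" "pauli_dot v $ 1 $ 2 = of_real (v $ 1) - \<i> * of_real (v $ 2)"
  "pauli_dot v $ 2 $ 1 = of_real (v $ 1) + \<i> * of_real (v $ 2)" "pauli_dot v $ 2 $ 2 = - of_real (v $ 3)"
  by (simp_all add: pauli_dot_def pauli_def sum_3 scaleR_conv_of_real[where 'a = complex])

lemma hermitian_pauli_dot: "hermitian (pauli_dot v)"
  by (simp add: hermitian_def dagger_def vec_eq_iff forall_2 pauli_dot_nth)

lemma trace_pauli_dot [simp]: "trace (pauli_dot v) = 0"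
  by (simp add: trace_def sum_2 pauli_dot_nth)

lemma linear_pauli_dot: "linear pauli_dot"
  by (auto simp: linear_iff vec_eq_iff forall_2 pauli_dot_nth algebra_simps
      scaleR_conv_of_real[where 'a = complex])

lemma mat_nth: "(mat c :: 'a::zero^'m^'m) $ a $ b = (if a = b then c else 0)"
  by (simp add: mat_def)

lemma mat_mult_nth: "(mat c ** A) $ a $ b = c * A $ a $ b" for A :: "'a::semiring_1^'m^'d"
  by (simp add: matrix_matrix_mult_def mat_def if_distrib if_distribR cong: if_cong)

lemma mult_nth_2: "(A ** B) $ a $ b = A $ a $ 1 * B $ 1 $ b + A $ a $ 2 * B $ 2 $ b"
  for B :: "'a::semiring_1^'m^2"
  by (simp add: matrix_matrix_mult_def sum_2)

lemma anticommutator_pauli_dot: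
  "anticommutator (pauli_dot a) (pauli_dot b) = (2 * (a \<bullet> b)) *\<^sub>R mat 1"
  by (simp add: anticommutator_def vec_eq_iff forall_2 mult_nth_2 pauli_dot_nth mat_nth inner_vec_def
      sum_3 algebra_simps scaleR_conv_of_real[where 'a = complex])

text \<open>The su(2) bracket carries a factor \<open>2 * \<i>\<close>; the prefactor
  \<open>- \<i>\<close>, which also relates \<open>dagger (U \<theta>) ** D\<close> to the
  generator, makes it real.\<close>

lemma commutator_pauli_dot:
  "mat (- \<i>) ** (pauli_dot a ** pauli_dot b - pauli_dot b ** pauli_dot a) =
    2 *\<^sub>R pauli_dot (cross3 a b)"
  by (simp add: vec_eq_iff forall_2 mult_nth_2 mat_nth pauli_dot_nth cross3_def algebra_simps
      scaleR_conv_of_real[where 'a = complex])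

lemma trace_pauli_mult:
  "trace (pauli 1 ** A) = A $ 1 $ 2 + A $ 2 $ 1"
  "trace (pauli 2 ** A) = \<i> * (A $ 1 $ 2 - A $ 2 $ 1)"
  "trace (pauli 3 ** A) = A $ 1 $ 1 - A $ 2 $ 2"
  by (simp_all add: trace_def sum_2 mult_nth_2 pauli_def algebra_simps)

lemma traceless_hermitian_iff_pauli_dot:
  "hermitian A \<and> trace A = 0 \<longleftrightarrow> (\<exists>m. A = pauli_dot m)"
proof
  assume "hermitian A \<and> trace A = 0"
  then have "cnj (A $ 1 $ 1) = A $ 1 $ 1" "A $ 2 $ 1 = cnj (A $ 1 $ 2)" "A $ 2 $ 2 = - (A $ 1 $ 1)"
    by (auto simp: hermitian_def dagger_def trace_def sum_2 vec_eq_iff add_eq_0_iff)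
  \<comment> \<open>The upper right entry of \<open>pauli_dot v\<close> has imaginary part
    \<open>- v $ 2\<close>, whence the sign of the second coordinate.\<close>
  then have "A = pauli_dot (vector [Re (A $ 1 $ 2), - Im (A $ 1 $ 2), Re (A $ 1 $ 1)])"
    by (simp add: vec_eq_iff forall_2 pauli_dot_nth complex_eq_iff)
  then show "\<exists>m. A = pauli_dot m" ..
qed (auto simp: hermitian_pauli_dot)

text \<open>The Pauli matrices are orthogonal for the trace form, with squared norm 2, so half the
  trace recovers a coordinate.\<close>

lemma pauli_dot_coefficients_iff:
  "(\<forall>k. complex_of_real (m $ k) = (1 / 2) * trace (pauli k ** pauli_dot v)) \<longleftrightarrow> m = v"
  by (auto simp: forall_3 trace_pauli_mult pauli_dot_nth vec_eq_iff complex_eq_iff)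

section \<open>Velocities of curves in SU(2)\<close>

lemma SU2_velocity:
  fixes V :: "real \<Rightarrow> cmat2"
  assumes D: "(V has_vector_derivative D) (at x)"
    and T: "open T" "x \<in> T" "\<And>t. t \<in> T \<Longrightarrow> V t \<in> SU2"
  shows "dagger (dagger (V x) ** D) = - (dagger (V x) ** D)" and "trace (dagger (V x) ** D) = 0"
proof -
  have U: "dagger (V t) ** V t = mat 1" "V t ** dagger (V t) = mat 1" "det (V t) = 1" if "t \<in> T" for t
    using T(3)[OF that] by (auto simp: SU2_def)
  have "((\<lambda>t. dagger (V t) ** V t) has_vector_derivative (dagger (V x) ** D + dagger D ** V x)) (at x)"
    by (intro has_vector_derivative_matrix_mult has_vector_derivative_dagger D)
  \<comment> \<open>The product is known to be constant only on \<open>T\<close>; openness of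
    \<open>T\<close> makes this enough at \<open>x\<close>.\<close>
  moreover have "((\<lambda>t. dagger (V t) ** V t) has_vector_derivative 0) (at x)"
    by (rule has_vector_derivative_transform_within_open [OF has_vector_derivative_const T(1,2)])
      (simp add: U)
  ultimately have "dagger (V x) ** D + dagger D ** V x = 0"
    by (rule vector_derivative_unique_at)
  then show "dagger (dagger (V x) ** D) = - (dagger (V x) ** D)"
    by (simp add: dagger_matrix_mult eq_neg_iff_add_eq_0 add.commute)
  have entry: "((\<lambda>t. V t $ a $ b) has_vector_derivative D $ a $ b) (at x)" for a b
    using bounded_linear.has_vector_derivative [OF bounded_linear_vec_nth
        bounded_linear.has_vector_derivative [OF bounded_linear_vec_nth D]] .
  have "((\<lambda>t. det (V t)) has_vector_derivative
     (V x $ 1 $ 1 * D $ 2 $ 2 + D $ 1 $ 1 * V x $ 2 $ 2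
        - (V x $ 1 $ 2 * D $ 2 $ 1 + D $ 1 $ 2 * V x $ 2 $ 1))) (at x)"
    unfolding det_2 by (intro has_vector_derivative_diff has_vector_derivative_mult entry)
  moreover have "((\<lambda>t. det (V t)) has_vector_derivative 0) (at x)"
    by (rule has_vector_derivative_transform_within_open [OF has_vector_derivative_const T(1,2)])
      (simp add: U)
  ultimately have det': "V x $ 1 $ 1 * D $ 2 $ 2 + D $ 1 $ 1 * V x $ 2 $ 2
        - (V x $ 1 $ 2 * D $ 2 $ 1 + D $ 1 $ 2 * V x $ 2 $ 1) = 0"
    by (rule vector_derivative_unique_at)
  \<comment> \<open>The adjugate of \<open>V x\<close>: as the determinant is 1, it is the inverse
    and hence \<open>dagger (V x)\<close>. By Jacobi's formula the trace of \<open>A ** D\<close> is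
    the derivative of the determinant.\<close>
  define A :: cmat2 where
    "A = vector [vector [V x $ 2 $ 2, - V x $ 1 $ 2], vector [- V x $ 2 $ 1, V x $ 1 $ 1]]"
  have "V x ** A = mat 1"
    using U(3)[OF T(2)]
    by (simp add: A_def vec_eq_iff forall_2 mult_nth_2 mat_nth det_2 algebra_simps)
  then have "dagger (V x) = A"
    by (metis U(1)[OF T(2)] matrix_mul_assoc matrix_mul_lid matrix_mul_rid)
  then show "trace (dagger (V x) ** D) = 0"
    using det' by (simp add: A_def trace_def sum_2 mult_nth_2 algebra_simps)
qed

section \<open>The projection and the Bloch form of the initial state\<close>

lemma ketbra_vector_mult: "ketbra u v *v w = cinner v w *s u"
  by (simp add: ketbra_def cinner_def matrix_vector_mult_def vec_eq_iff sum_distrib_right mult.assoc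
      mult.commute sum_distrib_left mult.left_commute)

lemma Lam_mult: "Lam n *v v = v - (n \<bullet> v) *\<^sub>R n"
  by (simp add: Lam_def vec_eq_iff forall_3 matrix_vector_mult_def matrix_matrix_mult_def mat_nth
      columnvector_def rowvector_def inner_vec_def sum_3 algebra_simps)

lemma is_orthogonal_projection_Lam:
  assumes "norm n = 1"
  shows "is_orthogonal_projection (Lam n) ({n}\<^sup>\<bottom>)"
proof -
  have "n \<bullet> n = 1"
    using assms by (simp add: norm_eq_1)
  then show ?thesis
    unfolding is_orthogonal_projection_def
    using subspace_orthogonal_comp [of "{n}"]
    by (auto simp: Lam_mult orthogonal_comp_def orthogonal_def inner_diff_right inner_commute)
qed

text \<open>Both sides act on \<open>\<phi>0\<close> and \<open>\<phi>1\<close> as multiplication by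
  \<open>p0\<close> and \<open>p1\<close>, since \<open>p0 + p1 = 1\<close> gives
  \<open>(1 + (p0 - p1)) / 2 = p0\<close> and its counterpart for \<open>p1\<close>. The two vectors
  span the space.\<close>

lemma bloch_form:
  assumes "orthonormal_basis \<phi>0 \<phi>1" and "p0 + p1 = 1"
    and "pauli_dot n *v \<phi>0 = \<phi>0" and "pauli_dot n *v \<phi>1 = - \<phi>1"
  shows "p0 *\<^sub>R ketbra \<phi>0 \<phi>0 + p1 *\<^sub>R ketbra \<phi>1 \<phi>1 =
    (1 / 2) *\<^sub>R (mat 1 + (p0 - p1) *\<^sub>R pauli_dot n)" (is "?R = ?B")
proof -
  have on: "cinner \<phi>0 \<phi>0 = 1" "cinner \<phi>1 \<phi>1 = 1" "cinner \<phi>0 \<phi>1 = 0"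
    and span: "vec.span {\<phi>0, \<phi>1} = UNIV"
    using assms(1) by (auto simp: orthonormal_basis_def)
  have "cinner \<phi>1 \<phi>0 = cnj (cinner \<phi>0 \<phi>1)"
    by (simp add: cinner_def mult.commute)
  then have on': "cinner \<phi>1 \<phi>0 = 0"
    by (simp add: on)
  have scale: "(c *\<^sub>R A) *v x = c *\<^sub>R (A *v x)" for c :: real and A :: cmat2 and x
    by (simp add: matrix_vector_mult_def vec_eq_iff scaleR_sum_right)
  have p: "(1 + (p0 - p1)) / 2 = p0" "(1 - (p0 - p1)) / 2 = p1"
    using assms(2) by (simp_all add: field_simps)
  have B: "?B *v x = (1 / 2) *\<^sub>R (x + (p0 - p1) *\<^sub>R (pauli_dot n *v x))" for x
    by (simp only: scale matrix_vector_mult_add_rdistrib matrix_vector_mul_lid)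
  have "?B *v \<phi>0 = ((1 + (p0 - p1)) / 2) *\<^sub>R \<phi>0" "?B *v \<phi>1 = ((1 - (p0 - p1)) / 2) *\<^sub>R \<phi>1"
    unfolding B assms(3,4) by (simp_all add: algebra_simps add_divide_distrib diff_divide_distrib)
  moreover have "?R *v \<phi>0 = p0 *\<^sub>R \<phi>0" "?R *v \<phi>1 = p1 *\<^sub>R \<phi>1"
    by (simp_all add: scale matrix_vector_mult_add_rdistrib ketbra_vector_mult on on')
  ultimately have eq: "?R *v x = ?B *v x" if "x \<in> {\<phi>0, \<phi>1}" for x
    using that p by auto
  have "?R *v x = ?B *v x" for x
    by (rule vec.linear_eq_on_span [where B = "{\<phi>0, \<phi>1}"]) (simp_all only: eq span UNIV_I
        matrix_vector_mul_linear_gen)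
  then show ?thesis
    by (simp add: matrix_eq)
qed

section \<open>SLDs along a unitary orbit and the traces they give\<close>

lemma is_SLD_unitary_orbit:
  fixes U :: "real^'n \<Rightarrow> cmat2"
  assumes D: "has_partial_derivative U D i \<theta>" and U: "U \<theta> \<in> SU2"
    and W: "dagger (U \<theta>) ** D = mat (- \<i>) ** pauli_dot m"
    and \<rho>: "\<And>\<theta>. \<rho> \<theta> = U \<theta> ** ((1 / 2) *\<^sub>R (mat 1 + r *\<^sub>R pauli_dot n)) ** dagger (U \<theta>)"
  shows "is_SLD \<rho> \<theta> i (U \<theta> ** ((2 * r) *\<^sub>R pauli_dot (cross3 m n)) ** dagger (U \<theta>))"
proof -
  let ?V = "U \<theta>" and ?P = pauli_dot
  define R where "R = (1 / 2) *\<^sub>R (mat 1 + r *\<^sub>R ?P n)"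
  \<comment> \<open>Twice the commutator of \<open>W\<close> (defined below) and \<open>R\<close>,
    that is, twice the derivative of the state seen in the frame of \<open>?V\<close>.\<close>
  define K where "K = (2 * r) *\<^sub>R ?P (cross3 m n)"
  have V: "dagger ?V ** ?V = mat 1" "?V ** dagger ?V = mat 1"
    using U by (auto simp: SU2_def)
  define W where "W = mat (- \<i>) ** ?P m"
  have D_eq: "D = ?V ** W"
    unfolding W_def assms(3) [symmetric] by (simp add: matrix_mul_assoc V)
  have W_skew: "dagger W = - W"
    by (simp add: W_def vec_eq_iff forall_2 dagger_def mult_nth_2 mat_nth pauli_dot_nth algebra_simps)
  have mat_i_commute: "A ** mat c = mat c ** A" for A :: cmat2 and c
    by (simp add: vec_eq_iff forall_2 mult_nth_2 mat_nth)
  have hK: "hermitian K"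
    using hermitian_pauli_dot [of "(2 * r) *\<^sub>R cross3 m n"]
    by (simp add: K_def linear_scale [OF linear_pauli_dot])
  have "W ** ?P n - ?P n ** W = mat (- \<i>) ** (?P m ** ?P n - ?P n ** ?P m)"
    by (simp add: W_def matrix_mult_algebra matrix_mul_assoc mat_i_commute)
  then have "W ** ?P n - ?P n ** W = 2 *\<^sub>R ?P (cross3 m n)"
    by (simp only: commutator_pauli_dot)
  moreover have "W ** R - R ** W = (r / 2) *\<^sub>R (W ** ?P n - ?P n ** W)"
    by (simp add: R_def matrix_mult_algebra algebra_simps)
  ultimately have comm: "W ** R - R ** W = (1 / 2) *\<^sub>R K"
    by (simp only: K_def scaleR_scaleR) simp
  \<comment> \<open>As \<open>cross3 m n\<close> is orthogonal to \<open>n\<close>, the Pauli part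
    of \<open>R\<close> contributes nothing, and its identity part returns \<open>K\<close>.\<close>
  have "anticommutator K (?P n) = 0"
    using anticommutator_scaleR [of "2 * r" "?P (cross3 m n)" 1 "?P n"]
    by (simp add: K_def anticommutator_pauli_dot dot_cross_self)
  moreover have "anticommutator K R = (1 / 2) *\<^sub>R (K + K) + (r / 2) *\<^sub>R anticommutator K (?P n)"
    by (simp add: R_def anticommutator_def matrix_mult_algebra scaleR_add_right)
  ultimately have acomm: "anticommutator K R = K"
    by simp
  have "((\<lambda>t. \<rho> (\<theta> + t *\<^sub>R axis i 1)) has_vector_derivative
      (?V ** R ** dagger D + (?V ** 0 + D ** R) ** dagger ?V)) (at 0)"
    unfolding \<rho> R_def [symmetric]
    using has_vector_derivative_matrix_mult
      [OF has_vector_derivative_matrix_mult [OF D [unfolded has_partial_derivative_def]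
          has_vector_derivative_const [of R]]
        has_vector_derivative_dagger [OF D [unfolded has_partial_derivative_def]]]
    by simp
  \<comment> \<open>With \<open>D = ?V ** W\<close> and \<open>W\<close> skew-Hermitian, the product
    rule collapses to a conjugated commutator; \<open>?V ** 0\<close> comes from the constant factor
    \<open>R\<close>.\<close>
  also have "?V ** R ** dagger D + (?V ** 0 + D ** R) ** dagger ?V = ?V ** (W ** R - R ** W) ** dagger ?V"
    by (simp add: D_eq dagger_matrix_mult W_skew matrix_mult_algebra matrix_mul_assoc)
  also have "\<dots> = (1 / 2) *\<^sub>R (?V ** K ** dagger ?V)"
    by (simp add: comm matrix_mult_algebra)
  also have "?V ** K ** dagger ?V = anticommutator (?V ** K ** dagger ?V) (\<rho> \<theta>)"
    by (simp add: \<rho> R_def [symmetric] anticommutator_unitary_conj V acomm)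
  finally show ?thesis
    using hK unfolding is_SLD_def has_partial_derivative_def K_def [symmetric]
    by (simp add: hermitian_unitary_conj)
qed

lemma trace_anticommutator_orbit_SLD:
  assumes V: "V \<in> SU2" and n: "norm n = 1"
    and R: "R = V ** ((1 / 2) *\<^sub>R (mat 1 + r *\<^sub>R pauli_dot n)) ** dagger V"
    and K: "\<And>m. K m = V ** ((2 * r) *\<^sub>R pauli_dot (cross3 m n)) ** dagger V"
  shows "(1 / 2) * trace (R ** anticommutator (K a) (K b)) =
    complex_of_real (4 * r\<^sup>2 * (a \<bullet> (Lam n *v b)))"
proof -
  have V': "dagger V ** V = mat 1"
    using V by (simp add: SU2_def)
  \<comment> \<open>Lagrange identity, with \<open>n \<bullet> n = 1\<close>.\<close>
  have "cross3 a n \<bullet> cross3 b n = a \<bullet> (Lam n *v b)"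
    using n by (simp add: dot_cross Lam_mult norm_eq_1 inner_diff_right inner_commute)
  \<comment> \<open>The 8 collects the two SLD factors \<open>2 * r\<close> and the 2 of
    \<open>anticommutator_pauli_dot\<close>.\<close>
  then have ac: "anticommutator (K a) (K b) = (8 * r\<^sup>2 * (a \<bullet> (Lam n *v b))) *\<^sub>R (V ** mat 1 ** dagger V)"
    by (simp add: K anticommutator_unitary_conj V' anticommutator_scaleR anticommutator_pauli_dot
        matrix_mult_algebra power2_eq_square mult.assoc)
  have "V ** mat 1 ** dagger V = mat 1"
    using V by (simp add: SU2_def)
  moreover have "trace R = 1"
    by (simp add: R trace_unitary_conj V' trace_scaleR trace_add trace_I)
  ultimately show ?thesis
    by (simp add: ac matrix_mult_algebra trace_scaleR)
qed

theorem proposition1: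
  fixes U :: "real^'n \<Rightarrow> complex^2^2"
    and S :: "(real^'n) set"
    and p0 p1 :: real
    and \<phi>0 \<phi>1 :: "complex^2"
    and n :: "real^3"
    and \<rho>0 :: "complex^2^2"
    and \<rho> :: "real^'n \<Rightarrow> complex^2^2"
  assumes "open S"
    and "U differentiable_on S"
    and "\<And>\<theta>. \<theta> \<in> S \<Longrightarrow> U \<theta> \<in> SU2"
    and "p0 \<ge> 0" and "p1 \<ge> 0" and "p0 + p1 = 1"
    and "orthonormal_basis \<phi>0 \<phi>1"
    and "norm n = 1"
    and "pauli_dot n *v \<phi>0 = \<phi>0"
    and "pauli_dot n *v \<phi>1 = - \<phi>1"
    and "\<rho>0 = p0 *\<^sub>R ketbra \<phi>0 \<phi>0 + p1 *\<^sub>R ketbra \<phi>1 \<phi>1"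
    and "\<And>\<theta>. \<rho> \<theta> = U \<theta> ** \<rho>0 ** dagger (U \<theta>)"
  shows "(\<forall>\<theta>\<in>S.
      (\<forall>i. \<exists>!m. is_generator_vector U \<theta> i m) \<and>
      (\<forall>m. (\<forall>i. is_generator_vector U \<theta> i (m i)) \<longrightarrow>
        (\<forall>F. is_QFIM \<rho> \<theta> F \<longleftrightarrow>
           (\<forall>i j. F $ i $ j =
              complex_of_real (4 * (p0 - p1)\<^sup>2 * (m i \<bullet> (Lam n *v m j))))) \<and>
        (\<forall>i j. 4 * (p0 - p1)\<^sup>2 * (m i \<bullet> (Lam n *v m j)) =
              4 * (p0 - p1)\<^sup>2 * (m i \<bullet> m j - (n \<bullet> m i) * (n \<bullet> m j))))) \<and>
    is_orthogonal_projection (Lam n) ({n}\<^sup>\<bottom>) \<and>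
    dim ({n}\<^sup>\<bottom>) = 2"
proof (intro conjI ballI)
  fix \<theta> assume \<theta>: "\<theta> \<in> S"
  let ?r = "p0 - p1" and ?V = "U \<theta>"
  define D where "D i = partial_derivative U i \<theta>" for i
  have V: "?V \<in> SU2"
    using assms(3) \<theta> .
  have D: "has_partial_derivative U (D i) i \<theta>" for i
  proof -
    have "U differentiable at \<theta>"
      using assms(1,2) \<theta> by (simp add: differentiable_on_eq_differentiable_at)
    then have "U \<circ> (\<lambda>t. \<theta> + t *\<^sub>R axis i 1) differentiable at 0"
      by (intro differentiable_chain_at) (auto intro!: derivative_intros)
    then show ?thesis
      by (simp add: D_def has_partial_derivative_def partial_derivative_def o_def
          flip: vector_derivative_works)
  qed
  have "\<exists>v. generator U \<theta> i = pauli_dot v" for i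
  proof -
    \<comment> \<open>The times at which the coordinate line through \<open>\<theta>\<close> lies in
      \<open>S\<close>: an open set containing 0 on which the curve stays in
      \<open>SU2\<close>.\<close>
    let ?T = "(\<lambda>t. \<theta> + t *\<^sub>R axis i 1) -` S"
    have "open ?T"
      using assms(1) by (intro open_vimage continuous_intros)
    then have vel: "dagger (dagger ?V ** D i) = - (dagger ?V ** D i)" "trace (dagger ?V ** D i) = 0"
      using SU2_velocity [OF D [unfolded has_partial_derivative_def], of ?T i] \<theta> assms(3) by auto
    \<comment> \<open>A skew-Hermitian matrix times \<open>\<i>\<close> is Hermitian.\<close>
    have "hermitian (generator U \<theta> i)"
      using vel(1) by (auto simp: hermitian_def generator_def D_def [symmetric] dagger_def vec_eq_iff
          mat_mult_nth)
    moreover have "trace (generator U \<theta> i) = 0"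
      using vel(2) by (simp add: trace_def generator_def D_def [symmetric] mat_mult_nth
          flip: sum_distrib_left)
    ultimately show ?thesis
      by (simp flip: traceless_hermitian_iff_pauli_dot)
  qed
  then obtain v where v: "generator U \<theta> i = pauli_dot (v i)" for i
    by metis
  \<comment> \<open>This gives existence and uniqueness at once, and lets any family
    \<open>m\<close> of generator vectors be replaced by \<open>v\<close>.\<close>
  have gv: "is_generator_vector U \<theta> i m \<longleftrightarrow> m = v i" for i m
    unfolding is_generator_vector_def v by (rule pauli_dot_coefficients_iff)
  then show "\<forall>i. \<exists>!m. is_generator_vector U \<theta> i m"
    by simp
  \<comment> \<open>The factor \<open>\<i>\<close> in the generator is undone by its inverse
    \<open>- \<i>\<close>.\<close>
  have "dagger ?V ** D i = mat (- \<i>) ** pauli_dot (v i)" for i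
    unfolding v [symmetric] generator_def D_def
    by (simp add: vec_eq_iff mat_mult_nth)
  moreover have \<rho>: "\<rho> \<theta> = U \<theta> ** ((1 / 2) *\<^sub>R (mat 1 + ?r *\<^sub>R pauli_dot n)) ** dagger (U \<theta>)" for \<theta>
    using bloch_form [OF assms(7,6,9,10)] assms(11,12) by simp
  ultimately have "is_SLD \<rho> \<theta> i (?V ** ((2 * ?r) *\<^sub>R pauli_dot (cross3 (v i) n)) ** dagger ?V)" for i
    using D V by (intro is_SLD_unitary_orbit)
  note qfim = is_QFIM_iff [OF this] trace_anticommutator_orbit_SLD [OF V assms(8) \<rho> refl]
  have "is_QFIM \<rho> \<theta> F \<longleftrightarrow>
      (\<forall>i j. F $ i $ j = complex_of_real (4 * ?r\<^sup>2 * (v i \<bullet> (Lam n *v v j))))" for F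
    by (simp only: qfim)
  moreover have "a \<bullet> (Lam n *v b) = a \<bullet> b - (n \<bullet> a) * (n \<bullet> b)" for a b
    by (simp add: Lam_mult inner_diff_right inner_commute)
  ultimately show "\<forall>m. (\<forall>i. is_generator_vector U \<theta> i (m i)) \<longrightarrow>
        (\<forall>F. is_QFIM \<rho> \<theta> F \<longleftrightarrow>
           (\<forall>i j. F $ i $ j =
              complex_of_real (4 * (p0 - p1)\<^sup>2 * (m i \<bullet> (Lam n *v m j))))) \<and>
        (\<forall>i j. 4 * (p0 - p1)\<^sup>2 * (m i \<bullet> (Lam n *v m j)) =
              4 * (p0 - p1)\<^sup>2 * (m i \<bullet> m j - (n \<bullet> m i) * (n \<bullet> m j)))"
    by (simp add: gv)
next
  show "is_orthogonal_projection (Lam n) ({n}\<^sup>\<bottom>)"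
    using assms(8) by (rule is_orthogonal_projection_Lam)
  \<comment> \<open>Seen as a hyperplane, the complement has dimension 3 - 1.\<close>
  have "{n}\<^sup>\<bottom> = {x. n \<bullet> x = 0}"
    by (auto simp: orthogonal_comp_def orthogonal_def)
  moreover have "n \<noteq> 0"
    using assms(8) by auto
  ultimately show "dim ({n}\<^sup>\<bottom>) = 2"
    by (simp add: dim_hyperplane)
qed

end
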